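(* Let $1\le k\le n$ and let $M:\mathbb{R}^n\times\mathbb{R}^n\to\mathbb{C}$ be a bounded Lipschitz function such that the matrix $[M(\mathbf{z}_i,\mathbf{z}_j)]_{i,j}$ is positive semidefinite for every finite collection $\{\mathbf{z}_i\}\subseteq\mathbb{R}^n$. Let $f=(T_g\otimes\delta^{n-k})_U\in\mathcal{G}'_k$ be such that $x_ig\in L_1(\mathbb{R}^k)$ for $i=1,\dots,k$. Then $\langle x_if|M|x_jf\rangle$ is defined for all $1\le i,j\le n$, and $\operatorname{rank}M_f\le k$.
   Context: $\mathcal{S}(\mathbb{R}^n)$ is the (complex) Schwartz space, $\mathcal{S}'(\mathbb{R}^n)$ the tempered distributions, and $T_f$ the distribution $\phi\mapsto\int f\phi$. For $g\in\mathcal{S}'(\mathbb{R}^k)$, $g\otimes\delta^{n-k}$ is its tensor product with the $(n-k)$-dimensional Dirac delta at the origin. For $h\in\mathcal{S}'(\mathbb{R}^n)$ and $U\in\mathcal{O}(n)=\{U\in\mathbb{R}^{n\times n}:U^TU=I_n\}$, $h_U$ is defined by $\langle h_U,\phi\rangle=\langle h,\psi\rangle$ with $\psi(\mathbf{x})=\phi(U^T\mathbf{x})$. $\mathcal{G}'_k=\{(h\otimes\delta^{n-k})_U: h\in\mathcal{S}'(\mathbb{R}^k),U\in\mathcal{O}(n)\}$. For a distribution $f$, $x_if$ is its product with the $i$-th coordinate function. $G^n_\epsilon(\mathbf{x})=(2\pi\epsilon^2)^{-n/2}e^{-\|\mathbf{x}\|^2/(2\epsilon^2)}$. For $f,g\in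 L_1(\mathbb{R}^n)$, $\langle f|M|g\rangle=\iint f(\mathbf{x})^*M(\mathbf{x},\mathbf{y})g(\mathbf{y})\,d\mathbf{x}\,d\mathbf{y}$ ($^*$ is complex conjugation). For general $f,g\in\mathcal{S}'(\mathbb{R}^n)$, $\langle f|M|g\rangle$ is said to be defined if there are $f_\epsilon,g_\epsilon\in L_1(\mathbb{R}^n)$ with $T_{f_\epsilon}=f*G^n_\epsilon$, $T_{g_\epsilon}=g*G^n_\epsilon$ and the limit $\lim_{\epsilon\to0}\langle f_\epsilon|M|g_\epsilon\rangle$ exists and is finite; then $\langle f|M|g\rangle$ is this limit. $M_f$ is the $n\times n$ real matrix $M_f=\left[\operatorname{Re}\langle x_if|M|x_jf\rangle\right]_{1\le i,j\le n}$. *)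

theory Defs
  imports "HOL-Analysis.Analysis" "HOL-Library.Nonpos_Ints"
begin

section \<open>Schwartz functions and tempered distributions\<close>

definition partial :: "'n::finite \<Rightarrow> (real^'n \<Rightarrow> complex) \<Rightarrow> real^'n \<Rightarrow> complex" where
  "partial i \<phi> x = vector_derivative (\<lambda>t. \<phi> (x + t *\<^sub>R axis i 1)) (at 0)"

fun partials :: "'n::finite list \<Rightarrow> (real^'n \<Rightarrow> complex) \<Rightarrow> real^'n \<Rightarrow> complex" where
  "partials [] \<phi> = \<phi>"
| "partials (i # is) \<phi> = partial i (partials is \<phi>)"

text \<open>Differentiability of all iterated partial derivatives makes them all continuous, so this
  is the class of infinitely differentiable functions. Lists of indices play the role of
  multi-indices.\<close>

definition smooth :: "(real^'n::finite \<Rightarrow> complex) \<Rightarrow> bool" where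
  "smooth \<phi> \<longleftrightarrow> (\<forall>is x. partials is \<phi> differentiable (at x))"

definition schwartz :: "(real^'n::finite \<Rightarrow> complex) set" where
  "schwartz = {\<phi>. smooth \<phi> \<and>
     (\<forall>N is. bounded (range (\<lambda>x. (1 + norm x) ^ N *\<^sub>R partials is \<phi> x)))}"

definition schwartz_seminorm :: "nat \<Rightarrow> 'n::finite list \<Rightarrow> (real^'n \<Rightarrow> complex) \<Rightarrow> real" where
  "schwartz_seminorm N is \<phi> = (SUP x. (1 + norm x) ^ N * norm (partials is \<phi> x))"

definition schwartz_tendsto ::
    "(nat \<Rightarrow> real^'n::finite \<Rightarrow> complex) \<Rightarrow> (real^'n \<Rightarrow> complex) \<Rightarrow> bool" where
  "schwartz_tendsto \<Phi> \<phi> \<longleftrightarrow>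
     (\<forall>N is. (\<lambda>m. schwartz_seminorm N is (\<lambda>x. \<Phi> m x - \<phi> x)) \<longlonglongrightarrow> 0)"

text \<open>A distribution is represented by a functional on all functions of which only the values on
  Schwartz functions are meaningful. Since countably many seminorms define
  the topology of the Schwartz space, continuity is sequential continuity.\<close>

type_synonym 'n functional = "(real^'n \<Rightarrow> complex) \<Rightarrow> complex"

definition tempered :: "'n::finite functional set" where
  "tempered = {T.
     (\<forall>\<phi>\<in>schwartz. \<forall>\<psi>\<in>schwartz. T (\<lambda>x. \<phi> x + \<psi> x) = T \<phi> + T \<psi>) \<and>
     (\<forall>\<phi>\<in>schwartz. \<forall>c. T (\<lambda>x. c * \<phi> x) = c * T \<phi>) \<and>
     (\<forall>\<Phi> \<phi>. (\<forall>m. \<Phi> m \<in> schwartz) \<and> \<phi> \<in> schwartz \<and> schwartz_tendsto \<Phi> \<phi> \<longrightarrow>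
        (\<lambda>m. T (\<Phi> m)) \<longlonglongrightarrow> T \<phi>)}"

definition dist_eq :: "'n::finite functional \<Rightarrow> 'n functional \<Rightarrow> bool" where
  "dist_eq S T \<longleftrightarrow> (\<forall>\<phi>\<in>schwartz. S \<phi> = T \<phi>)"

definition dist_of :: "(real^'n::finite \<Rightarrow> complex) \<Rightarrow> 'n functional" where
  "dist_of g \<phi> = (LINT x|lebesgue. g x * \<phi> x)"

text \<open>The integrability condition excludes functions for which the integral above would be
  zero only by the convention for non-integrable functions.\<close>

definition induces_tempered :: "(real^'n::finite \<Rightarrow> complex) \<Rightarrow> bool" where
  "induces_tempered g \<longleftrightarrow>
     (\<forall>\<phi>\<in>schwartz. integrable lebesgue (\<lambda>x. g x * \<phi> x)) \<and> dist_of g \<in> tempered"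

definition coord_mult :: "'n::finite \<Rightarrow> 'n functional \<Rightarrow> 'n functional" where
  "coord_mult i T \<phi> = T (\<lambda>x. of_real (x $ i) * \<phi> x)"

text \<open>Convolution \<open>T * \<psi>\<close> with a Schwartz function: \<open>\<langle>T * \<psi>, \<phi>\<rangle> = \<langle>T, \<psi>' * \<phi>\<rangle>\<close>
  with \<open>\<psi>' x = \<psi> (- x)\<close>.\<close>

definition dist_conv :: "'n::finite functional \<Rightarrow> (real^'n \<Rightarrow> complex) \<Rightarrow> 'n functional" where
  "dist_conv T \<psi> \<phi> = T (\<lambda>x. LINT y|lebesgue. \<psi> (y - x) * \<phi> y)"

section \<open>Distributions supported on subspaces\<close>

text \<open>The \<open>k\<close>-dimensional space is identified with a coordinate subspace of the
  \<open>n\<close>-dimensional one by an injection \<open>\<iota>\<close> of the index types (whose existence means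
  \<open>k \<le> n\<close>); the usual choice is that of the first \<open>k\<close> coordinates.\<close>

definition embed :: "('k::finite \<Rightarrow> 'n::finite) \<Rightarrow> real^'k \<Rightarrow> real^'n" where
  "embed \<iota> t = (\<Sum>l\<in>UNIV. (t $ l) *\<^sub>R axis (\<iota> l) 1)"

text \<open>Tensor product of \<open>h\<close> with the Dirac delta in the coordinates outside the range of
  \<open>\<iota>\<close>: evaluating the delta sets these coordinates to zero.\<close>

definition tensor_delta :: "('k::finite \<Rightarrow> 'n::finite) \<Rightarrow> 'k functional \<Rightarrow> 'n functional" where
  "tensor_delta \<iota> h \<phi> = h (\<lambda>t. \<phi> (embed \<iota> t))"

definition dist_rotate :: "real^'n^'n::finite \<Rightarrow> 'n functional \<Rightarrow> 'n functional" where
  "dist_rotate U h \<phi> = h (\<lambda>x. \<phi> (transpose U *v x))"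

definition subspace_dists :: "('k::finite \<Rightarrow> 'n::finite) \<Rightarrow> 'n functional set" where
  "subspace_dists \<iota> = {dist_rotate U (tensor_delta \<iota> h) | h U. h \<in> tempered \<and> orthogonal_matrix U}"

section \<open>The sesquilinear form of a kernel\<close>

definition gaussian :: "real \<Rightarrow> real^'n::finite \<Rightarrow> complex" where
  "gaussian \<epsilon> x = of_real ((2 * pi * \<epsilon>\<^sup>2) powr (- real CARD('n) / 2) *
     exp (- (norm x)\<^sup>2 / (2 * \<epsilon>\<^sup>2)))"

definition bracket_L1 ::
    "((real^'n) \<times> (real^'n) \<Rightarrow> complex) \<Rightarrow> (real^'n \<Rightarrow> complex) \<Rightarrow> (real^'n::finite \<Rightarrow> complex) \<Rightarrow> complex" where
  "bracket_L1 M f g = (LINT x|lebesgue. LINT y|lebesgue. cnj (f x) * M (x, y) * g y)"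

definition has_bracket ::
    "((real^'n) \<times> (real^'n) \<Rightarrow> complex) \<Rightarrow> 'n::finite functional \<Rightarrow> 'n functional \<Rightarrow> complex \<Rightarrow> bool" where
  "has_bracket M f g L \<longleftrightarrow> (\<exists>F G.
     (\<forall>\<epsilon>>0. integrable lebesgue (F \<epsilon>) \<and> dist_eq (dist_of (F \<epsilon>)) (dist_conv f (gaussian \<epsilon>)) \<and>
            integrable lebesgue (G \<epsilon>) \<and> dist_eq (dist_of (G \<epsilon>)) (dist_conv g (gaussian \<epsilon>))) \<and>
     ((\<lambda>\<epsilon>. bracket_L1 M (F \<epsilon>) (G \<epsilon>)) \<longlongrightarrow> L) (at_right (0::real)))"

definition bracket_defined ::
    "((real^'n) \<times> (real^'n) \<Rightarrow> complex) \<Rightarrow> 'n::finite functional \<Rightarrow> 'n functional \<Rightarrow> bool" where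
  "bracket_defined M f g \<longleftrightarrow> (\<exists>L. has_bracket M f g L)"

text \<open>The limit is unique: the distributional identity determines \<open>F \<epsilon>\<close> and \<open>G \<epsilon>\<close>
  up to null sets.\<close>

definition bracket ::
    "((real^'n) \<times> (real^'n) \<Rightarrow> complex) \<Rightarrow> 'n::finite functional \<Rightarrow> 'n functional \<Rightarrow> complex" where
  "bracket M f g = (THE L. has_bracket M f g L)"

definition bracket_matrix ::
    "((real^'n) \<times> (real^'n) \<Rightarrow> complex) \<Rightarrow> 'n::finite functional \<Rightarrow> real^'n^'n" where
  "bracket_matrix M f = (\<chi> i j. Re (bracket M (coord_mult i f) (coord_mult j f)))"

definition psd :: "nat \<Rightarrow> (nat \<Rightarrow> nat \<Rightarrow> complex) \<Rightarrow> bool" where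
  "psd m A \<longleftrightarrow> (\<forall>i<m. \<forall>j<m. A j i = cnj (A i j)) \<and>
     (\<forall>c. (\<Sum>i<m. \<Sum>j<m. cnj (c i) * A i j * c j) \<in> \<real>\<^sub>\<ge>\<^sub>0)"

definition psd_kernel :: "('a \<times> 'a \<Rightarrow> complex) \<Rightarrow> bool" where
  "psd_kernel M \<longleftrightarrow> (\<forall>m z. psd m (\<lambda>i j. M (z i, z j)))"

end

theory Submission
  imports Defs "HOL-Probability.Distributions"
begin

text \<open>
  In the coordinates of the \<open>k\<close>-dimensional space the distribution \<open>f\<close> is \<open>\<phi> \<mapsto> \<integral> g(t) \<phi>(A t) dt\<close>, where
  \<open>A = U\<^sup>T \<circ> embed \<iota>\<close> is linear. Multiplication by \<open>x\<^sub>i\<close> turns the density \<open>g\<close> into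
  \<open>h\<^sub>i(t) = (A t)\<^sub>i g(t)\<close>, a linear combination of the functions \<open>t\<^sub>l g(t)\<close> and therefore
  integrable. So \<open>x\<^sub>i f\<close> is the image under \<open>A\<close> of a finite complex measure, and its
  convolution with a Gaussian is the integrable function
  \<open>y \<mapsto> \<integral> h\<^sub>i(t) G\<^sub>\<epsilon>(y - A t) dt\<close>.

  A Gaussian average of a \<open>K\<close>-Lipschitz function differs from the value at the centre by \<open>O(K \<epsilon>)\<close>.
  Applied to the kernel in one argument after the other (\<open>bracket_L1_smoothing\<close>), this shows that
  the brackets of the smoothed functions converge to
  \<open>\<integral>\<integral> cnj (h\<^sub>i(s)) M(A s, A t) h\<^sub>j(t) ds dt\<close> (\<open>has_bracket_pushforward\<close>).

  The bracket is defined by a definite description over all choices of smoothed functions, so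
  its value is known only once the limit is unique (\<open>has_bracket_unique\<close>). Two choices have the same
  integrals against Schwartz functions, in particular against all translates of Gaussians of
  all widths. By the same estimate on Gaussian averages these determine the integrals
  against bounded Lipschitz functions, and a bracket is an iterated integral of that kind.

  The limit is sesquilinear in the two densities. Expanding \<open>h\<^sub>i = \<Sum>\<^sub>l P\<^sub>i\<^sub>l t\<^sub>l g\<close>, with \<open>P\<close> the \<open>n \<times> k\<close>
  matrix of \<open>A\<close>, gives \<open>M\<^sub>f = P Q P\<^sup>T\<close> with a real \<open>k \<times> k\<close> matrix \<open>Q\<close>, so the rank is at most that of \<open>P\<close>.
\<close>

section \<open>Moments of the Gaussian\<close>

text \<open>Written as a product of one-dimensional normal densities, the Gaussian has integrals that factor
  over the coordinates, so its moments reduce to those of the normal distribution on the line.\<close>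

definition gaussian_density :: "real \<Rightarrow> real^'n::finite \<Rightarrow> real" where
  "gaussian_density \<epsilon> x = (\<Prod>b\<in>Basis. normal_density 0 \<epsilon> (x \<bullet> b))"

lemma gaussian_density_nonneg: "0 \<le> gaussian_density \<epsilon> x"
  by (simp add: gaussian_density_def prod_nonneg)

lemma borel_measurable_gaussian_density [measurable]: "gaussian_density \<epsilon> \<in> borel_measurable borel"
  unfolding gaussian_density_def[abs_def] by measurable

lemma gaussian_eq_density:
  fixes x :: "real^'n::finite"
  assumes "\<epsilon> > 0"
  shows "gaussian \<epsilon> x = of_real (gaussian_density \<epsilon> x)"
proof -
  define c where "c = 2 * pi * \<epsilon>\<^sup>2"
  have c: "c > 0" using assms by (simp add: c_def)
  have "(1 / sqrt c) ^ CARD('n) = (c powr (- 1 / 2)) powr real CARD('n)"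
    using c by (simp add: powr_half_sqrt powr_realpow powr_minus_divide)
  also have "\<dots> = c powr (- real CARD('n) / 2)"
    by (simp only: powr_powr) simp
  finally have "(1 / sqrt c) ^ CARD('n) = c powr (- real CARD('n) / 2)" .
  moreover have "(\<Prod>b\<in>Basis. exp (- (x \<bullet> b)\<^sup>2 / (2 * \<epsilon>\<^sup>2))) = exp (- (norm x)\<^sup>2 / (2 * \<epsilon>\<^sup>2))"
    by (simp add: exp_sum[symmetric] sum_divide_distrib[symmetric] sum_negf
        power2_norm_eq_inner euclidean_inner[of x x] power2_eq_square[symmetric])
  moreover have "gaussian_density \<epsilon> x =
      (1 / sqrt c) ^ CARD('n) * (\<Prod>b\<in>Basis. exp (- (x \<bullet> b)\<^sup>2 / (2 * \<epsilon>\<^sup>2)))"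
    unfolding gaussian_density_def normal_density_def prod.distrib by (simp add: c_def)
  ultimately show ?thesis
    by (simp add: gaussian_def c_def)
qed

lemma nn_integral_gaussian_density:
  assumes "\<epsilon> > 0"
  shows "(\<integral>\<^sup>+x. gaussian_density \<epsilon> (x::real^'n::finite) \<partial>lborel) = 1"
proof -
  have "(\<integral>\<^sup>+x. normal_density 0 \<epsilon> x \<partial>lborel) = 1"
    using assms by (subst nn_integral_eq_integral) auto
  then show ?thesis
    unfolding gaussian_density_def
    by (subst prod_ennreal[symmetric], simp, subst nn_integral_lborel_prod) auto
qed

lemma nn_integral_gaussian_density_coordinate:
  fixes b :: "real^'n::finite"
  assumes \<epsilon>: "\<epsilon> > 0" and b: "b \<in> Basis"
  shows "(\<integral>\<^sup>+x. gaussian_density \<epsilon> x * \<bar>x \<bullet> b\<bar> \<partial>lborel) = ennreal (\<epsilon> * sqrt (2 / pi))"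
proof -
  define f where "f b' t = normal_density 0 \<epsilon> t * (if b' = b then \<bar>t\<bar> else 1)" for b' :: "real^'n" and t
  have f: "f b' \<in> borel_measurable borel" "f b' t \<ge> 0" for b' t
    by (auto simp: f_def[abs_def])
  have eq: "gaussian_density \<epsilon> x * \<bar>x \<bullet> b\<bar> = (\<Prod>b'\<in>Basis. f b' (x \<bullet> b'))" for x
    using b by (simp add: gaussian_density_def f_def prod.distrib prod.delta)
  have "(\<integral>\<^sup>+x. gaussian_density \<epsilon> x * \<bar>x \<bullet> b\<bar> \<partial>lborel) = (\<Prod>b'\<in>Basis. \<integral>\<^sup>+t. f b' t \<partial>lborel)"
    unfolding eq by (subst prod_ennreal[symmetric], simp add: f, subst nn_integral_lborel_prod) (auto simp: f)
  also have "\<dots> = (\<Prod>b'\<in>Basis. if b' = b then ennreal (\<epsilon> * sqrt (2 / pi)) else 1)"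
  proof (rule prod.cong[OF refl])
    fix b' :: "real^'n"
    show "(\<integral>\<^sup>+t. f b' t \<partial>lborel) = (if b' = b then ennreal (\<epsilon> * sqrt (2 / pi)) else 1)"
      using normal_moment_abs_odd[OF \<epsilon>, of 0 0] \<epsilon>
      by (auto simp: f_def nn_integral_eq_integral has_bochner_integral_iff)
  qed
  also have "\<dots> = ennreal (\<epsilon> * sqrt (2 / pi))"
    using b by (simp add: prod.delta)
  finally show ?thesis .
qed

text \<open>The norm is dominated by the sum of the absolute values of the coordinates, and a centred normal
  variable with standard deviation \<open>\<epsilon>\<close> has absolute mean \<open>\<epsilon> * sqrt (2 / pi) \<le> \<epsilon>\<close>. What matters
  below is that the bound vanishes linearly in \<open>\<epsilon>\<close>.\<close>

lemma gaussian_density_first_moment: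
  fixes \<epsilon> :: real
  assumes \<epsilon>: "\<epsilon> > 0"
  shows "(\<integral>\<^sup>+x. gaussian_density \<epsilon> (x::real^'n::finite) * norm x \<partial>lborel) \<le> ennreal (real CARD('n) * \<epsilon>)"
proof -
  have "(\<integral>\<^sup>+x. gaussian_density \<epsilon> (x::real^'n::finite) * norm x \<partial>lborel)
      \<le> (\<integral>\<^sup>+x. (\<Sum>b\<in>Basis. ennreal (gaussian_density \<epsilon> (x::real^'n) * \<bar>x \<bullet> b\<bar>)) \<partial>lborel)"
    by (intro nn_integral_mono)
      (simp add: gaussian_density_nonneg sum_distrib_left[symmetric] mult_left_mono norm_le_l1)
  also have "\<dots> = (\<Sum>b\<in>(Basis::(real^'n) set). ennreal (\<epsilon> * sqrt (2 / pi)))"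
    by (subst nn_integral_sum) (auto simp: nn_integral_gaussian_density_coordinate[OF \<epsilon>])
  also have "\<dots> \<le> (\<Sum>b\<in>(Basis::(real^'n) set). ennreal \<epsilon>)"
    using \<epsilon> pi_gt3 by (intro sum_mono ennreal_leI) (auto simp: mult_le_cancel_left1)
  also have "\<dots> = ennreal (real CARD('n) * \<epsilon>)"
    using \<epsilon> by (simp add: ennreal_mult ennreal_of_nat_eq_real_of_nat)
  finally show ?thesis .
qed

lemma lborel_translate_nn_integral:
  fixes f :: "'a::euclidean_space \<Rightarrow> ennreal"
  assumes [measurable]: "f \<in> borel_measurable borel"
  shows "(\<integral>\<^sup>+x. f (x - a) \<partial>lborel) = (\<integral>\<^sup>+x. f x \<partial>lborel)"
  by (subst (2) lborel_distr_plus[of "-a", symmetric]) (simp add: nn_integral_distr)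

lemma borel_measurable_gaussian [measurable]: "gaussian \<epsilon> \<in> borel_measurable borel"
  unfolding gaussian_def[abs_def] by measurable

lemma gaussian_integral:
  fixes a :: "real^'n::finite"
  assumes \<epsilon>: "\<epsilon> > 0"
  shows "integrable lborel (\<lambda>y. gaussian \<epsilon> (y - a))"
    and "(LINT y|lborel. gaussian \<epsilon> (y - a)) = 1"
    and "(LINT y|lborel. norm (gaussian \<epsilon> (y - a))) = 1"
proof -
  have n: "(\<integral>\<^sup>+y. norm (gaussian \<epsilon> (y - a)) \<partial>lborel) = 1"
    using nn_integral_gaussian_density[OF \<epsilon>, where 'n='n]
      lborel_translate_nn_integral[of "\<lambda>x. ennreal (gaussian_density \<epsilon> x)" a] \<epsilon>
    by (simp add: gaussian_eq_density gaussian_density_nonneg)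
  show "integrable lborel (\<lambda>y. gaussian \<epsilon> (y - a))"
    using n by (intro integrableI_bounded) auto
  have "(LINT y|lborel. gaussian_density \<epsilon> (y - a)) = 1"
    using n \<epsilon> by (intro integral_eq_nn_integral[THEN trans])
      (auto simp: gaussian_eq_density gaussian_density_nonneg)
  then show "(LINT y|lborel. gaussian \<epsilon> (y - a)) = 1"
    using \<epsilon> by (simp add: gaussian_eq_density)
  show "(LINT y|lborel. norm (gaussian \<epsilon> (y - a))) = 1"
    using n by (intro integral_eq_nn_integral[THEN trans]) auto
qed

lemma gaussian_first_moment:
  fixes a :: "real^'n::finite"
  assumes \<epsilon>: "\<epsilon> > 0"
  shows "integrable lborel (\<lambda>y. norm (gaussian \<epsilon> (y - a)) * norm (y - a))"
    and "(LINT y|lborel. norm (gaussian \<epsilon> (y - a)) * norm (y - a)) \<le> real CARD('n) * \<epsilon>"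
proof -
  have n: "(\<integral>\<^sup>+y. norm (gaussian \<epsilon> (y - a)) * norm (y - a) \<partial>lborel) \<le> ennreal (real CARD('n) * \<epsilon>)"
    using gaussian_density_first_moment[OF \<epsilon>, where 'n='n]
      lborel_translate_nn_integral[of "\<lambda>x. ennreal (gaussian_density \<epsilon> x * norm x)" a] \<epsilon>
    by (simp add: gaussian_eq_density gaussian_density_nonneg)
  show I: "integrable lborel (\<lambda>y. norm (gaussian \<epsilon> (y - a)) * norm (y - a))"
    using n by (intro integrableI_bounded) (auto intro: le_less_trans)
  show "(LINT y|lborel. norm (gaussian \<epsilon> (y - a)) * norm (y - a)) \<le> real CARD('n) * \<epsilon>"
    using n nn_integral_eq_integral[OF I] \<epsilon> by simp
qed

section \<open>Gaussian smoothing of pushforwards\<close>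

lemma sigma_finite_lebesgue: "sigma_finite_measure (lebesgue :: 'a::euclidean_space measure)"
proof
  obtain A :: "'a set set" where A: "countable A" "A \<subseteq> sets lborel" "\<Union>A = space lborel"
      "\<forall>a\<in>A. emeasure lborel a \<noteq> \<infinity>"
    using lborel.sigma_finite_countable by blast
  show "\<exists>A::'a set set. countable A \<and> A \<subseteq> sets lebesgue \<and> \<Union>A = space lebesgue \<and>
      (\<forall>a\<in>A. emeasure lebesgue a \<noteq> \<infinity>)"
  proof (intro exI conjI)
    show "A \<subseteq> sets lebesgue" using A by auto
    show "\<forall>a\<in>A. emeasure lebesgue a \<noteq> \<infinity>"
      using A by auto
  qed (use A in auto)
qed

lemma integrable_mult_bounded:
  fixes h \<psi> :: "'a \<Rightarrow> complex"
  assumes h: "integrable N h" and [measurable]: "\<psi> \<in> borel_measurable N"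
    and B: "\<And>x. norm (\<psi> x) \<le> B"
  shows "integrable N (\<lambda>x. h x * \<psi> x)"
proof (rule Bochner_Integration.integrable_bound)
  show "integrable N (\<lambda>x. B * norm (h x))"
    using h by simp
  have "norm (h x) * norm (\<psi> x) \<le> \<bar>B * norm (h x)\<bar>" for x
    using mult_left_mono[OF B[of x] norm_ge_zero[of "h x"]] by (simp add: mult.commute)
  then show "AE x in N. norm (h x * \<psi> x) \<le> norm (B * norm (h x))"
    by (simp add: norm_mult)
qed (use h in measurable)

lemma norm_integral_le:
  fixes f :: "'a \<Rightarrow> complex"
  assumes "integrable N f" "integrable N B" "\<And>x. norm (f x) \<le> B x"
  shows "norm (integral\<^sup>L N f) \<le> integral\<^sup>L N B"
  by (rule order_trans[OF integral_norm_bound]) (use assms in \<open>auto intro!: integral_mono\<close>)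

lemma lipschitz_borel_measurable:
  fixes \<psi> :: "'a::euclidean_space \<Rightarrow> complex"
  shows "K-lipschitz_on UNIV \<psi> \<Longrightarrow> \<psi> \<in> borel_measurable borel"
  by (intro borel_measurable_continuous_onI lipschitz_on_continuous_on)

text \<open>A Lipschitz function changes by at most \<open>K * norm (y - a)\<close> between \<open>a\<close> and \<open>y\<close>, so its average
  against the Gaussian centred at \<open>a\<close> is off from \<open>\<psi> a\<close> by at most \<open>K\<close> times the first absolute moment.
  Both the existence of brackets and their uniqueness rest on this estimate.\<close>

lemma gaussian_average_lipschitz:
  fixes \<psi> :: "real^'n::finite \<Rightarrow> complex"
  assumes \<epsilon>: "\<epsilon> > 0" and K: "K-lipschitz_on UNIV \<psi>" and B: "\<And>x. norm (\<psi> x) \<le> B"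
  shows "norm ((LINT y|lborel. gaussian \<epsilon> (y - a) * \<psi> y) - \<psi> a) \<le> K * (real CARD('n) * \<epsilon>)"
proof -
  note [measurable] = lipschitz_borel_measurable[OF K]
  have I: "integrable lborel (\<lambda>y. gaussian \<epsilon> (y - a) * \<psi> y)"
    by (rule integrable_mult_bounded[OF gaussian_integral(1)[OF \<epsilon>] _ B]) simp
  have I': "integrable lborel (\<lambda>y. gaussian \<epsilon> (y - a) * \<psi> a)"
    by (rule integrable_mult_left) (rule gaussian_integral(1)[OF \<epsilon>])
  have "(LINT y|lborel. gaussian \<epsilon> (y - a) * \<psi> y) - \<psi> a
      = (LINT y|lborel. gaussian \<epsilon> (y - a) * \<psi> y - gaussian \<epsilon> (y - a) * \<psi> a)"
    using gaussian_integral(2)[OF \<epsilon>, of a] by (subst Bochner_Integration.integral_diff[OF I I']) simp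
  also have "norm \<dots> \<le> (LINT y|lborel. K * (norm (gaussian \<epsilon> (y - a)) * norm (y - a)))"
  proof (rule norm_integral_le)
    show "integrable lborel (\<lambda>y. gaussian \<epsilon> (y - a) * \<psi> y - gaussian \<epsilon> (y - a) * \<psi> a)"
      using I I' by (rule Bochner_Integration.integrable_diff)
    show "integrable lborel (\<lambda>y. K * (norm (gaussian \<epsilon> (y - a)) * norm (y - a)))"
      using gaussian_first_moment(1)[OF \<epsilon>, of a] by simp
    fix y
    have "norm (gaussian \<epsilon> (y - a) * \<psi> y - gaussian \<epsilon> (y - a) * \<psi> a)
        = norm (gaussian \<epsilon> (y - a)) * norm (\<psi> y - \<psi> a)"
      by (simp add: norm_mult[symmetric] algebra_simps)
    also have "\<dots> \<le> norm (gaussian \<epsilon> (y - a)) * (K * norm (y - a))"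
      using lipschitz_on_normD[OF K] by (intro mult_left_mono) auto
    finally show "norm (gaussian \<epsilon> (y - a) * \<psi> y - gaussian \<epsilon> (y - a) * \<psi> a)
        \<le> K * (norm (gaussian \<epsilon> (y - a)) * norm (y - a))"
      by (simp add: mult_ac)
  qed
  also have "\<dots> \<le> K * (real CARD('n) * \<epsilon>)"
    using gaussian_first_moment(2)[OF \<epsilon>, of a] lipschitz_on_nonneg[OF K] by (simp add: mult_left_mono)
  finally show ?thesis .
qed

text \<open>The functional given by the image under \<open>A\<close> of the complex measure with density \<open>h\<close>. Every
  distribution whose bracket is needed has this form, with an integrable \<open>h\<close>; the case
  \<open>A = (\<lambda>x. x)\<close> also covers the distribution of an integrable function.\<close>

definition pushforward :: "'a measure \<Rightarrow> ('a \<Rightarrow> complex) \<Rightarrow> ('a \<Rightarrow> real^'n) \<Rightarrow> 'n::finite functional" where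
  "pushforward N h A \<phi> = (LINT t|N. h t * \<phi> (A t))"

locale weighted_map = sigma_finite_measure N for N :: "'a measure" +
  fixes h :: "'a \<Rightarrow> complex" and A :: "'a \<Rightarrow> real^'n::finite"
  assumes h: "integrable N h" and A [measurable]: "A \<in> borel_measurable N"
begin

text \<open>The density of the convolution of the pushforward with the Gaussian. It is an honest integrable
  function even when \<open>A\<close> maps into a proper subspace and the pushforward is singular.\<close>

definition smoothing :: "real \<Rightarrow> real^'n \<Rightarrow> complex" where
  "smoothing \<epsilon> y = (LINT t|N. h t * gaussian \<epsilon> (y - A t))"

sublocale P: pair_sigma_finite N "lborel :: (real^'n) measure" ..

lemma h_measurable [measurable]: "h \<in> borel_measurable N"
  using h by simp

lemma integrable_kernel:
  assumes \<epsilon>: "\<epsilon> > 0"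
  shows "integrable (N \<Otimes>\<^sub>M lborel) (\<lambda>(t, y). h t * gaussian \<epsilon> (y - A t))"
proof (rule P.Fubini_integrable)
  show "integrable N (\<lambda>t. LINT y|lborel. norm (case (t, y) of (t, y) \<Rightarrow> h t * gaussian \<epsilon> (y - A t)))"
    using h by (simp add: norm_mult gaussian_integral(3)[OF \<epsilon>])
  show "AE t in N. integrable lborel (\<lambda>y. case (t, y) of (t, y) \<Rightarrow> h t * gaussian \<epsilon> (y - A t))"
    unfolding prod.case by (intro AE_I2 integrable_mult_right gaussian_integral(1)[OF \<epsilon>])
qed measurable

lemma integrable_smoothing: "\<epsilon> > 0 \<Longrightarrow> integrable lborel (smoothing \<epsilon>)"
  unfolding smoothing_def[abs_def] by (rule P.integrable_snd[OF integrable_kernel])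

lemma smoothing_norm:
  assumes \<epsilon>: "\<epsilon> > 0"
  shows "(LINT y|lborel. norm (smoothing \<epsilon> y)) \<le> (LINT t|N. norm (h t))"
proof -
  have I: "integrable (N \<Otimes>\<^sub>M lborel) (\<lambda>(t, y). norm (h t * gaussian \<epsilon> (y - A t)))"
    using integrable_norm[OF integrable_kernel[OF \<epsilon>]] by (simp add: case_prod_unfold)
  have "(LINT y|lborel. norm (smoothing \<epsilon> y)) \<le> (LINT y|lborel. LINT t|N. norm (h t * gaussian \<epsilon> (y - A t)))"
    by (intro integral_mono integrable_norm integrable_smoothing \<epsilon> P.integrable_snd[OF I])
      (simp add: smoothing_def)
  also have "\<dots> = (LINT t|N. LINT y|lborel. norm (h t * gaussian \<epsilon> (y - A t)))"
    by (rule P.Fubini_integral[OF I])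
  also have "\<dots> = (LINT t|N. norm (h t))"
    by (simp add: norm_mult gaussian_integral(3)[OF \<epsilon>])
  finally show ?thesis .
qed

text \<open>Fubini, for the kernel that is integrable on the product because each Gaussian has
  mass one. For Schwartz \<open>\<psi>\<close> the identity says that \<open>smoothing \<epsilon>\<close> represents the convolution
  (\<open>dist_of_smoothing\<close>); for Lipschitz \<open>\<psi>\<close> it leads to the approximation estimate
  \<open>smoothing_approximates\<close>.\<close>

lemma smoothing_duality:
  assumes \<epsilon>: "\<epsilon> > 0" and [measurable]: "\<psi> \<in> borel_measurable borel" and B: "\<And>x. norm (\<psi> x) \<le> B"
  shows "(LINT y|lborel. smoothing \<epsilon> y * \<psi> y)
      = pushforward N h A (\<lambda>x. LINT y|lborel. gaussian \<epsilon> (y - x) * \<psi> y)"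
    and "integrable N (\<lambda>t. h t * (LINT y|lborel. gaussian \<epsilon> (y - A t) * \<psi> y))"
proof -
  have "integrable (N \<Otimes>\<^sub>M lborel) (\<lambda>z. (case z of (t, y) \<Rightarrow> h t * gaussian \<epsilon> (y - A t)) * \<psi> (snd z))"
    by (rule integrable_mult_bounded[OF integrable_kernel[OF \<epsilon>] _ B]) simp
  then have I: "integrable (N \<Otimes>\<^sub>M lborel) (\<lambda>(t, y). h t * gaussian \<epsilon> (y - A t) * \<psi> y)"
    by (simp add: case_prod_unfold)
  have "(LINT y|lborel. smoothing \<epsilon> y * \<psi> y) = (LINT y|lborel. LINT t|N. h t * gaussian \<epsilon> (y - A t) * \<psi> y)"
    unfolding smoothing_def integral_mult_left_zero ..
  also have "\<dots> = (LINT t|N. LINT y|lborel. h t * gaussian \<epsilon> (y - A t) * \<psi> y)"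
    by (rule P.Fubini_integral[OF I])
  finally show "(LINT y|lborel. smoothing \<epsilon> y * \<psi> y)
      = pushforward N h A (\<lambda>x. LINT y|lborel. gaussian \<epsilon> (y - x) * \<psi> y)"
    by (simp add: pushforward_def mult.assoc)
  show "integrable N (\<lambda>t. h t * (LINT y|lborel. gaussian \<epsilon> (y - A t) * \<psi> y))"
    using P.integrable_fst[OF I] by (simp add: mult.assoc)
qed

lemma smoothing_approximates:
  assumes \<epsilon>: "\<epsilon> > 0" and K: "K-lipschitz_on UNIV \<psi>" and B: "\<And>x. norm (\<psi> x) \<le> B"
  shows "norm ((LINT y|lborel. smoothing \<epsilon> y * \<psi> y) - pushforward N h A \<psi>)
      \<le> (LINT t|N. norm (h t)) * (K * (real CARD('n) * \<epsilon>))"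
proof -
  note [measurable] = lipschitz_borel_measurable[OF K]
  \<comment> \<open>By duality only the error of the Gaussian averages, uniform in \<open>t\<close>, has to be integrated against \<open>h\<close>.\<close>
  let ?a = "\<lambda>x. LINT y|lborel. gaussian \<epsilon> (y - x) * \<psi> y"
  note dual = smoothing_duality[OF \<epsilon> lipschitz_borel_measurable[OF K] B]
  have I: "integrable N (\<lambda>t. h t * \<psi> (A t))"
    by (rule integrable_mult_bounded[OF h _ B]) simp
  have "(LINT y|lborel. smoothing \<epsilon> y * \<psi> y) - pushforward N h A \<psi>
      = (LINT t|N. h t * ?a (A t) - h t * \<psi> (A t))"
    using dual(2) I by (simp add: dual(1) pushforward_def)
  also have "norm \<dots> \<le> (LINT t|N. norm (h t) * (K * (real CARD('n) * \<epsilon>)))"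
  proof (rule norm_integral_le)
    fix t
    show "norm (h t * ?a (A t) - h t * \<psi> (A t)) \<le> norm (h t) * (K * (real CARD('n) * \<epsilon>))"
      unfolding right_diff_distrib[symmetric] norm_mult
      by (intro mult_left_mono gaussian_average_lipschitz[OF \<epsilon> K B]) simp
  qed (use dual(2) I h in auto)
  finally show ?thesis by simp
qed

end

section \<open>Gaussians as Schwartz functions\<close>

text \<open>Polynomials in \<open>x - a\<close> times a Gaussian centred at \<open>a\<close>, generated by the operations that occur
  in the product rule. The set is closed under partial derivatives and its members decay rapidly,
  so for \<open>\<sigma> > 0\<close> all of them are Schwartz functions without any formula for the higher derivatives.\<close>

inductive_set gaussian_polys :: "real \<Rightarrow> real^'n::finite \<Rightarrow> (real^'n \<Rightarrow> complex) set"
  for \<sigma> :: real and a :: "real^'n" where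
  base: "(\<lambda>x. gaussian \<sigma> (a - x)) \<in> gaussian_polys \<sigma> a"
| coord: "p \<in> gaussian_polys \<sigma> a \<Longrightarrow> (\<lambda>x. of_real ((x - a) $ i) * p x) \<in> gaussian_polys \<sigma> a"
| scale: "p \<in> gaussian_polys \<sigma> a \<Longrightarrow> (\<lambda>x. c * p x) \<in> gaussian_polys \<sigma> a"
| add: "p \<in> gaussian_polys \<sigma> a \<Longrightarrow> q \<in> gaussian_polys \<sigma> a \<Longrightarrow> (\<lambda>x. p x + q x) \<in> gaussian_polys \<sigma> a"

lemma power_le_fact_exp:
  assumes "(r::real) \<ge> 0"
  shows "r ^ N \<le> fact N * exp r"
proof -
  have "r ^ N / fact N = (\<Sum>n\<in>{N}. r ^ n /\<^sub>R fact n)"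
    by (simp add: field_simps)
  also have "\<dots> \<le> exp r"
    unfolding exp_def using assms by (intro sum_le_suminf summable_exp_generic) auto
  finally show ?thesis by (simp add: field_simps)
qed

text \<open>Both factors are compared with exponentials: \<open>(1 + norm x) ^ N \<le> fact N * exp (1 + norm x)\<close>, and
  completing the square gives \<open>r - r\<^sup>2 / (2 * \<sigma>\<^sup>2) \<le> \<sigma>\<^sup>2 / 2\<close> for the distance \<open>r\<close> from \<open>a\<close>.\<close>

lemma gaussian_rapid_decay:
  fixes a :: "real^'n::finite"
  assumes \<sigma>: "\<sigma> > 0"
  shows "\<exists>B. \<forall>x. (1 + norm x) ^ N * norm (gaussian \<sigma> (a - x)) \<le> B"
proof -
  define C where "C = (2 * pi * \<sigma>\<^sup>2) powr (- real CARD('n) / 2)"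
  have "(1 + norm x) ^ N * norm (gaussian \<sigma> (a - x))
      \<le> fact N * exp (1 + norm a + \<sigma>\<^sup>2 / 2) * C" for x
  proof -
    define r where "r = norm (a - x)"
    have "0 \<le> (r - \<sigma>\<^sup>2)\<^sup>2 / (2 * \<sigma>\<^sup>2)" by simp
    also have "\<dots> = r\<^sup>2 / (2 * \<sigma>\<^sup>2) + \<sigma>\<^sup>2 / 2 - r"
      using \<sigma> by (simp add: field_simps power2_eq_square)
    finally have "r - r\<^sup>2 / (2 * \<sigma>\<^sup>2) \<le> \<sigma>\<^sup>2 / 2" by simp
    moreover have "norm x \<le> norm a + r"
      unfolding r_def by norm
    ultimately have "exp (1 + norm x + - r\<^sup>2 / (2 * \<sigma>\<^sup>2)) \<le> exp (1 + norm a + \<sigma>\<^sup>2 / 2)"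
      by simp
    then have e: "exp (1 + norm x) * exp (- r\<^sup>2 / (2 * \<sigma>\<^sup>2)) \<le> exp (1 + norm a + \<sigma>\<^sup>2 / 2)"
      by (simp only: exp_add)
    have "(1 + norm x) ^ N * norm (gaussian \<sigma> (a - x)) = (1 + norm x) ^ N * (C * exp (- r\<^sup>2 / (2 * \<sigma>\<^sup>2)))"
      by (simp add: gaussian_def C_def r_def norm_mult)
    also have "\<dots> \<le> (fact N * exp (1 + norm x)) * (C * exp (- r\<^sup>2 / (2 * \<sigma>\<^sup>2)))"
      by (intro mult_right_mono power_le_fact_exp) (auto simp: C_def)
    also have "\<dots> = fact N * (exp (1 + norm x) * exp (- r\<^sup>2 / (2 * \<sigma>\<^sup>2))) * C"
      by simp
    also have "\<dots> \<le> fact N * exp (1 + norm a + \<sigma>\<^sup>2 / 2) * C"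
      by (intro mult_right_mono mult_left_mono e) (auto simp: C_def)
    finally show ?thesis .
  qed
  then show ?thesis by blast
qed

text \<open>A coordinate factor costs one power of \<open>1 + norm x\<close>, which is why the induction is carried out
  for all \<open>N\<close> at once.\<close>

lemma gaussian_polys_rapid_decay:
  assumes "p \<in> gaussian_polys \<sigma> a" and \<sigma>: "\<sigma> > 0"
  shows "\<exists>B. \<forall>x. (1 + norm x) ^ N * norm (p x) \<le> B"
  using assms(1)
proof (induction arbitrary: N)
  case base
  then show ?case using gaussian_rapid_decay[OF \<sigma>] .
next
  case (coord p i)
  obtain B where B: "\<And>x. (1 + norm x) ^ Suc N * norm (p x) \<le> B"
    using coord.IH by blast
  have "(1 + norm x) ^ N * norm (of_real ((x - a) $ i) * p x) \<le> (1 + norm a) * B" for x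
  proof -
    have "\<bar>(x - a) $ i\<bar> \<le> norm x + norm a"
      using component_le_norm_cart[of "x - a" i] norm_triangle_ineq4[of x a] by linarith
    also have "\<dots> \<le> (1 + norm a) * (1 + norm x)"
      by (simp add: algebra_simps)
    finally have c: "\<bar>(x - a) $ i\<bar> \<le> (1 + norm a) * (1 + norm x)" .
    have "(1 + norm x) ^ N * norm (of_real ((x - a) $ i) * p x)
        = \<bar>(x - a) $ i\<bar> * ((1 + norm x) ^ N * norm (p x))"
      by (simp add: norm_mult del: vector_minus_component)
    also have "\<dots> \<le> (1 + norm a) * (1 + norm x) * ((1 + norm x) ^ N * norm (p x))"
      by (intro mult_right_mono c) simp
    also have "\<dots> = (1 + norm a) * ((1 + norm x) ^ Suc N * norm (p x))"
      by simp
    also have "\<dots> \<le> (1 + norm a) * B"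
      by (intro mult_left_mono B) simp
    finally show ?thesis .
  qed
  then show ?case by blast
next
  case (scale p c)
  obtain B where B: "\<And>x. (1 + norm x) ^ N * norm (p x) \<le> B"
    using scale.IH by blast
  have "(1 + norm x) ^ N * norm (c * p x) \<le> norm c * B" for x
    using mult_left_mono[OF B[of x] norm_ge_zero[of c]] by (simp add: norm_mult mult_ac)
  then show ?case by blast
next
  case (add p q)
  obtain B B' where B: "\<And>x. (1 + norm x) ^ N * norm (p x) \<le> B"
      "\<And>x. (1 + norm x) ^ N * norm (q x) \<le> B'"
    using add.IH by meson
  have "(1 + norm x) ^ N * norm (p x + q x) \<le> B + B'" for x
  proof -
    have "(1 + norm x) ^ N * norm (p x + q x) \<le> (1 + norm x) ^ N * (norm (p x) + norm (q x))"
      by (intro mult_left_mono norm_triangle_ineq) simp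
    also have "\<dots> \<le> B + B'"
      using add_mono[OF B(1)[of x] B(2)[of x]] by (simp add: distrib_left)
    finally show ?thesis .
  qed
  then show ?case by blast
qed

lemma gaussian_has_derivative:
  fixes a :: "real^'n::finite"
  assumes \<sigma>: "\<sigma> > 0"
  shows "((\<lambda>x. gaussian \<sigma> (a - x)) has_derivative
    (\<lambda>v. \<Sum>i\<in>UNIV. of_real (v $ i) * (of_real (- 1 / \<sigma>\<^sup>2) * (of_real ((x - a) $ i) * gaussian \<sigma> (a - x))))) (at x)"
proof -
  define C where "C = (2 * pi * \<sigma>\<^sup>2) powr (- real CARD('n) / 2)"
  define k where "k = - 1 / \<sigma>\<^sup>2"
  define g where "g y = C * exp ((a - y) \<bullet> (a - y) * (k / 2))" for y
  have eq: "gaussian \<sigma> (a - y) = of_real (g y)" for y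
    by (simp add: gaussian_def g_def C_def k_def power2_norm_eq_inner)
  have "((\<lambda>y. (a - y) \<bullet> (a - y)) has_derivative (\<lambda>v. 2 * (v \<bullet> (x - a)))) (at x)"
    by (auto intro!: derivative_eq_intros simp: inner_diff_right inner_commute)
  moreover have "DERIV (\<lambda>s. C * exp (s * (k / 2))) ((a - x) \<bullet> (a - x)) :> g x * (k / 2)"
    unfolding g_def by (auto intro!: derivative_eq_intros)
  ultimately have "(g has_derivative (\<lambda>v. 2 * (v \<bullet> (x - a)) * (g x * (k / 2)))) (at x)"
    unfolding g_def[abs_def] by (intro DERIV_compose_FDERIV)
  from has_derivative_of_real[OF this, where 'a=complex]
  have "((\<lambda>x. gaussian \<sigma> (a - x)) has_derivative
      (\<lambda>v. of_real (2 * (v \<bullet> (x - a)) * (g x * (k / 2))))) (at x)"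
    unfolding eq .
  moreover have "(\<Sum>i\<in>UNIV. v $ i * (k * ((x - a) $ i * g x))) = 2 * (v \<bullet> (x - a)) * (g x * (k / 2))" for v
  proof -
    have "(\<Sum>i\<in>UNIV. v $ i * (k * ((x - a) $ i * g x))) = (\<Sum>i\<in>UNIV. v $ i * (x - a) $ i * (g x * k))"
      by (rule sum.cong) auto
    then show ?thesis
      by (simp add: inner_vec_def sum_distrib_right)
  qed
  then have "(\<Sum>i\<in>UNIV. of_real (v $ i) * (of_real k * (of_real ((x - a) $ i) * gaussian \<sigma> (a - x))))
      = (of_real (2 * (v \<bullet> (x - a)) * (g x * (k / 2))) :: complex)" for v
    unfolding eq of_real_mult[symmetric] of_real_sum[symmetric] by simp
  ultimately show ?thesis
    by (simp only: k_def)
qed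

text \<open>The total derivative, rather than the partial ones alone, is what differentiability in the
  definition of smoothness requires; its coefficients are the partial derivatives.\<close>

lemma gaussian_polys_derivative:
  fixes a :: "real^'n::finite"
  assumes "p \<in> gaussian_polys \<sigma> a" and \<sigma>: "\<sigma> > 0"
  shows "\<exists>D. (\<forall>i. D i \<in> gaussian_polys \<sigma> a) \<and>
    (\<forall>x. (p has_derivative (\<lambda>v. \<Sum>i\<in>UNIV. of_real (v $ i) * D i x)) (at x))"
  using assms(1)
proof induction
  case base
  show ?case
    by (rule exI[of _ "\<lambda>i x. of_real (- 1 / \<sigma>\<^sup>2) * (of_real ((x - a) $ i) * gaussian \<sigma> (a - x))"])
      (intro conjI allI gaussian_has_derivative[OF \<sigma>]
        gaussian_polys.scale[OF gaussian_polys.coord[OF gaussian_polys.base]])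
next
  case (coord p j)
  then obtain D where D: "\<And>i. D i \<in> gaussian_polys \<sigma> a"
      "\<And>x. (p has_derivative (\<lambda>v. \<Sum>i\<in>UNIV. of_real (v $ i) * D i x)) (at x)"
    by blast
  let ?D = "\<lambda>i x. of_real ((x - a) $ j) * D i x + (if i = j then 1 else 0) * p x"
  show ?case
  proof (intro exI[of _ ?D] conjI allI)
    fix i
    show "?D i \<in> gaussian_polys \<sigma> a"
      by (intro gaussian_polys.add gaussian_polys.scale gaussian_polys.coord D coord.hyps)
  next
    fix x
    have c: "((\<lambda>x. of_real ((x - a) $ j) :: complex) has_derivative (\<lambda>v. of_real (v $ j))) (at x)"
      by (intro has_derivative_of_real bounded_linear.has_derivative[OF bounded_linear_vec_nth])
        (auto intro!: derivative_eq_intros)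
    show "((\<lambda>x. of_real ((x - a) $ j) * p x) has_derivative
        (\<lambda>v. \<Sum>i\<in>UNIV. of_real (v $ i) * ?D i x)) (at x)"
    proof (rule has_derivative_eq_rhs[OF has_derivative_mult[OF c D(2)[of x]]], rule ext)
      fix v :: "real^'n"
      have "(\<Sum>i\<in>UNIV. of_real (v $ i) * ((if i = j then 1 else 0) * p x))
          = (\<Sum>i\<in>UNIV. if i = j then of_real (v $ j) * p x else 0)"
        by (rule sum.cong) auto
      then have "(\<Sum>i\<in>UNIV. of_real (v $ i) * ((if i = j then 1 else 0) * p x)) = of_real (v $ j) * p x"
        by simp
      then have "(\<Sum>i\<in>UNIV. of_real (v $ i) * ?D i x)
          = (\<Sum>i\<in>UNIV. of_real (v $ i) * (of_real ((x - a) $ j) * D i x)) + of_real (v $ j) * p x"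
        by (simp only: distrib_left sum.distrib)
      also have "(\<Sum>i\<in>UNIV. of_real (v $ i) * (of_real ((x - a) $ j) * D i x))
          = of_real ((x - a) $ j) * (\<Sum>i\<in>UNIV. of_real (v $ i) * D i x)"
        by (simp only: sum_distrib_left mult.left_commute)
      finally show "of_real ((x - a) $ j) * (\<Sum>i\<in>UNIV. of_real (v $ i) * D i x) + of_real (v $ j) * p x
          = (\<Sum>i\<in>UNIV. of_real (v $ i) * ?D i x)"
        by (rule sym)
    qed
  qed
next
  case (scale p c)
  then obtain D where D: "\<And>i. D i \<in> gaussian_polys \<sigma> a"
      "\<And>x. (p has_derivative (\<lambda>v. \<Sum>i\<in>UNIV. of_real (v $ i) * D i x)) (at x)"
    by blast
  show ?case
  proof (intro exI[of _ "\<lambda>i x. c * D i x"] conjI allI)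
    show "((\<lambda>x. c * p x) has_derivative (\<lambda>v. \<Sum>i\<in>UNIV. of_real (v $ i) * (c * D i x))) (at x)" for x
      using has_derivative_mult_right[OF D(2)[of x], of c]
      by (rule has_derivative_eq_rhs) (simp add: fun_eq_iff sum_distrib_left mult_ac)
  qed (intro gaussian_polys.scale D)
next
  case (add p q)
  then obtain D E where D: "\<And>i. D i \<in> gaussian_polys \<sigma> a"
      "\<And>x. (p has_derivative (\<lambda>v. \<Sum>i\<in>UNIV. of_real (v $ i) * D i x)) (at x)"
    and E: "\<And>i. E i \<in> gaussian_polys \<sigma> a"
      "\<And>x. (q has_derivative (\<lambda>v. \<Sum>i\<in>UNIV. of_real (v $ i) * E i x)) (at x)"
    by blast
  show ?case
  proof (intro exI[of _ "\<lambda>i x. D i x + E i x"] conjI allI)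
    show "((\<lambda>x. p x + q x) has_derivative
        (\<lambda>v. \<Sum>i\<in>UNIV. of_real (v $ i) * (D i x + E i x))) (at x)" for x
      using has_derivative_add[OF D(2)[of x] E(2)[of x]]
      by (rule has_derivative_eq_rhs) (simp add: fun_eq_iff distrib_left sum.distrib)
  qed (intro gaussian_polys.add D E)
qed

lemma partial_eqI:
  fixes p :: "real^'n::finite \<Rightarrow> complex"
  assumes "(p has_derivative (\<lambda>v. \<Sum>i\<in>UNIV. of_real (v $ i) * D i)) (at x)"
  shows "partial i p x = D i"
proof -
  have "((\<lambda>t::real. x + t *\<^sub>R axis i 1) has_derivative (\<lambda>t. t *\<^sub>R axis i 1)) (at 0)"
    by (rule derivative_eq_intros refl | simp)+
  moreover have "(p has_derivative (\<lambda>v. \<Sum>i\<in>UNIV. of_real (v $ i) * D i)) (at (x + 0 *\<^sub>R axis i 1))"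
    using assms by simp
  ultimately have "(p \<circ> (\<lambda>t. x + t *\<^sub>R axis i 1) has_derivative
      (\<lambda>v. \<Sum>i\<in>UNIV. of_real (v $ i) * D i) \<circ> (\<lambda>t. t *\<^sub>R axis i 1)) (at 0)"
    by (rule diff_chain_at)
  moreover have "(\<Sum>k\<in>UNIV. of_real ((t *\<^sub>R axis i 1) $ k) * D k) = t *\<^sub>R D i" for t :: real
  proof -
    have "(\<Sum>k\<in>UNIV. of_real ((t *\<^sub>R axis i 1) $ k) * D k) = (\<Sum>k\<in>UNIV. if k = i then t *\<^sub>R D i else 0)"
      by (rule sum.cong) (auto simp: axis_def scaleR_conv_of_real[where 'a=complex])
    then show ?thesis by simp
  qed
  ultimately have "((\<lambda>t. p (x + t *\<^sub>R axis i 1)) has_vector_derivative D i) (at 0)"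
    unfolding has_vector_derivative_def o_def by (simp only:)
  then show ?thesis
    unfolding partial_def by (rule vector_derivative_at)
qed

lemma gaussian_polys_partial:
  assumes "p \<in> gaussian_polys \<sigma> a" and \<sigma>: "\<sigma> > 0"
  shows "partial i p \<in> gaussian_polys \<sigma> a"
proof -
  obtain D where D: "\<And>i. D i \<in> gaussian_polys \<sigma> a"
      "\<And>x. (p has_derivative (\<lambda>v. \<Sum>i\<in>UNIV. of_real (v $ i) * D i x)) (at x)"
    using gaussian_polys_derivative[OF assms] by blast
  have "partial i p = D i"
    using partial_eqI[OF D(2)] by (auto simp: fun_eq_iff)
  then show ?thesis using D(1) by simp
qed

lemma schwartz_gaussian:
  assumes \<sigma>: "\<sigma> > 0"
  shows "(\<lambda>x. gaussian \<sigma> (a - x)) \<in> schwartz"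
proof -
  have P: "partials is (\<lambda>x. gaussian \<sigma> (a - x)) \<in> gaussian_polys \<sigma> a" for "is"
    by (induction "is") (auto intro: gaussian_polys.base gaussian_polys_partial \<sigma>)
  have "partials is (\<lambda>x. gaussian \<sigma> (a - x)) differentiable at x" for "is" x
  proof -
    obtain D where "\<forall>x. (partials is (\<lambda>x. gaussian \<sigma> (a - x)) has_derivative
        (\<lambda>v. \<Sum>i\<in>UNIV. of_real (v $ i) * D i x)) (at x)"
      using gaussian_polys_derivative[OF P[of "is"] \<sigma>] by blast
    then show ?thesis
      unfolding differentiable_def by blast
  qed
  moreover have "bounded (range (\<lambda>x. (1 + norm x) ^ N *\<^sub>R partials is (\<lambda>x. gaussian \<sigma> (a - x)) x))" for N "is"
  proof -
    obtain B where "\<forall>x. (1 + norm x) ^ N * norm (partials is (\<lambda>x. gaussian \<sigma> (a - x)) x) \<le> B"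
      using gaussian_polys_rapid_decay[OF P \<sigma>] by blast
    then show ?thesis
      by (auto simp: bounded_iff)
  qed
  ultimately show ?thesis
    by (auto simp: schwartz_def smooth_def)
qed

section \<open>The bracket of two pushforwards\<close>

lemma lipschitz_on_slices:
  fixes M :: "'a::metric_space \<times> 'b::metric_space \<Rightarrow> 'c::metric_space"
  assumes "K-lipschitz_on UNIV M"
  shows "K-lipschitz_on UNIV (\<lambda>x. M (x, y))" and "K-lipschitz_on UNIV (\<lambda>y. M (x, y))"
proof -
  have "dist (M (x, y)) (M (x', y)) \<le> K * dist x x'" for x x'
    using lipschitz_onD[OF assms, of "(x, y)" "(x', y)"] by (simp add: dist_Pair_Pair)
  then show "K-lipschitz_on UNIV (\<lambda>x. M (x, y))"
    by (intro lipschitz_onI lipschitz_on_nonneg[OF assms])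
  have "dist (M (x, y)) (M (x, y')) \<le> K * dist y y'" for y y'
    using lipschitz_onD[OF assms, of "(x, y)" "(x, y')"] by (simp add: dist_Pair_Pair)
  then show "K-lipschitz_on UNIV (\<lambda>y. M (x, y))"
    by (intro lipschitz_onI lipschitz_on_nonneg[OF assms])
qed

text \<open>Integrating out one variable of the kernel against an integrable weight leaves a bounded
  Lipschitz function of the other variable. This allows the one-variable estimates to be
  applied to the two arguments of the kernel in turn.\<close>

lemma weighted_average_lipschitz:
  fixes \<Phi> :: "'b::metric_space \<Rightarrow> 'a \<Rightarrow> complex"
  assumes w: "integrable N w" and meas: "\<And>x. \<Phi> x \<in> borel_measurable N"
    and B: "\<And>x t. norm (\<Phi> x t) \<le> B" and K: "\<And>t. K-lipschitz_on UNIV (\<lambda>x. \<Phi> x t)" "K \<ge> 0"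
  shows "((LINT t|N. norm (w t)) * K)-lipschitz_on UNIV (\<lambda>x. LINT t|N. w t * \<Phi> x t)"
    and "norm (LINT t|N. w t * \<Phi> x t) \<le> (LINT t|N. norm (w t)) * B"
proof -
  have I: "integrable N (\<lambda>t. w t * \<Phi> x t)" for x
    by (rule integrable_mult_bounded[OF w meas B])
  show "((LINT t|N. norm (w t)) * K)-lipschitz_on UNIV (\<lambda>x. LINT t|N. w t * \<Phi> x t)"
  proof (rule lipschitz_onI)
    fix x y :: 'b
    have "(LINT t|N. w t * \<Phi> x t) - (LINT t|N. w t * \<Phi> y t) = (LINT t|N. w t * \<Phi> x t - w t * \<Phi> y t)"
      using I by simp
    also have "norm \<dots> \<le> (LINT t|N. norm (w t) * (K * dist x y))"
    proof (rule norm_integral_le)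
      fix t
      show "norm (w t * \<Phi> x t - w t * \<Phi> y t) \<le> norm (w t) * (K * dist x y)"
        unfolding right_diff_distrib[symmetric] norm_mult
        using lipschitz_onD[OF K(1), of x y t] by (intro mult_left_mono) (auto simp: dist_norm)
    qed (use I w in auto)
    finally show "dist (LINT t|N. w t * \<Phi> x t) (LINT t|N. w t * \<Phi> y t) \<le> (LINT t|N. norm (w t)) * K * dist x y"
      by (simp add: dist_norm mult.assoc)
  qed (use K in simp)
  have "norm (LINT t|N. w t * \<Phi> x t) \<le> (LINT t|N. norm (w t) * B)"
    by (rule norm_integral_le) (use I w in \<open>auto simp: norm_mult intro!: mult_left_mono B\<close>)
  then show "norm (LINT t|N. w t * \<Phi> x t) \<le> (LINT t|N. norm (w t)) * B"
    by simp
qed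

lemma bracket_L1_iterated:
  "bracket_L1 M F G = (LINT x|lebesgue. cnj (F x) * (LINT y|lebesgue. G y * M (x, y)))"
  unfolding bracket_L1_def
  by (subst integral_mult_right_zero[symmetric]) (simp add: mult_ac)

lemma integral_cnj_mult:
  "(LINT x|N. cnj (F x) * \<psi> x) = cnj (LINT x|N. F x * cnj (\<psi> x))"
  using Bochner_Integration.integral_cnj[of N "\<lambda>x. F x * cnj (\<psi> x)"] by simp

lemma lipschitz_on_cnj: "K-lipschitz_on S \<psi> \<Longrightarrow> K-lipschitz_on S (\<lambda>x. cnj (\<psi> x))"
  by (simp add: lipschitz_on_def dist_norm complex_cnj_diff[symmetric] del: complex_cnj_diff)

text \<open>The value at which the brackets of the smoothings arrive for \<open>\<epsilon> \<rightarrow> 0\<close>: the double integral of the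
  kernel against the two image measures, pulled back to the parameter spaces.\<close>

definition weighted_bracket ::
    "((real^'n) \<times> (real^'n) \<Rightarrow> complex) \<Rightarrow> 'a measure \<Rightarrow> ('a \<Rightarrow> complex) \<Rightarrow> ('a \<Rightarrow> real^'n) \<Rightarrow>
     'b measure \<Rightarrow> ('b \<Rightarrow> complex) \<Rightarrow> ('b \<Rightarrow> real^'n::finite) \<Rightarrow> complex" where
  "weighted_bracket M N h A N' h' A' = (LINT s|N. cnj (h s) * (LINT t|N'. h' t * M (A s, A' t)))"

text \<open>The two arguments are desmoothed one after the other. Replacing the inner integral \<open>W\<close> against the
  second smoothing by the integral \<open>V\<close> against the pushforward itself changes it uniformly by
  \<open>O(\<epsilon>)\<close>, and the first smoothing has an \<open>L\<^sup>1\<close> norm bounded independently of \<open>\<epsilon>\<close>. As \<open>V\<close> is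
  Lipschitz, the remaining outer integral is again within \<open>O(\<epsilon>)\<close> of its limit.\<close>

lemma bracket_L1_smoothing:
  fixes M :: "(real^'n::finite) \<times> (real^'n) \<Rightarrow> complex"
  assumes X: "weighted_map N h A" and Y: "weighted_map N' h' A'"
    and K: "K-lipschitz_on UNIV M" and B: "\<And>z. norm (M z) \<le> B" and \<epsilon>: "\<epsilon> > 0"
  shows "norm (bracket_L1 M (weighted_map.smoothing N h A \<epsilon>) (weighted_map.smoothing N' h' A' \<epsilon>)
      - weighted_bracket M N h A N' h' A')
    \<le> 2 * (LINT t|N. norm (h t)) * (LINT t|N'. norm (h' t)) * K * real CARD('n) * \<epsilon>"
proof -
  interpret X: weighted_map N h A by fact
  interpret Y: weighted_map N' h' A' by fact
  note K0 = lipschitz_on_nonneg[OF K]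
  note slices = lipschitz_on_slices[OF K]
  note [measurable] = lipschitz_borel_measurable[OF slices(2)]
  let ?H = "LINT t|N. norm (h t)" and ?H' = "LINT t|N'. norm (h' t)"
  define W where "W x = (LINT y|lborel. Y.smoothing \<epsilon> y * M (x, y))" for x
  define V where "V x = (LINT t|N'. h' t * M (x, A' t))" for x
  let ?S = "LINT y|lborel. norm (Y.smoothing \<epsilon> y)"
  have W: "(?S * K)-lipschitz_on UNIV W" "norm (W x) \<le> ?S * B" for x
    unfolding W_def
    by (rule weighted_average_lipschitz[OF Y.integrable_smoothing[OF \<epsilon>] _ B slices(1) K0], simp)+
  have V: "(?H' * K)-lipschitz_on UNIV V" "norm (V x) \<le> ?H' * B" for x
    unfolding V_def by (rule weighted_average_lipschitz[OF Y.h _ B slices(1) K0], simp)+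
  note [measurable] = lipschitz_borel_measurable[OF W(1)] lipschitz_borel_measurable[OF V(1)]
  have [measurable]: "X.smoothing \<epsilon> \<in> borel_measurable borel" "Y.smoothing \<epsilon> \<in> borel_measurable borel"
    using X.integrable_smoothing[OF \<epsilon>] Y.integrable_smoothing[OF \<epsilon>] by auto
  have WV: "norm (W x - V x) \<le> ?H' * (K * (real CARD('n) * \<epsilon>))" for x
    using Y.smoothing_approximates[OF \<epsilon> slices(2) B] by (simp add: W_def V_def pushforward_def)
  have I: "integrable lborel (\<lambda>x. cnj (X.smoothing \<epsilon> x) * W x)"
          "integrable lborel (\<lambda>x. cnj (X.smoothing \<epsilon> x) * V x)"
    using X.integrable_smoothing[OF \<epsilon>]
    by (auto intro!: integrable_mult_bounded[OF _ _ W(2)] integrable_mult_bounded[OF _ _ V(2)])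
  have b: "bracket_L1 M (X.smoothing \<epsilon>) (Y.smoothing \<epsilon>) = (LINT x|lborel. cnj (X.smoothing \<epsilon> x) * W x)"
    using borel_measurable_integrable[OF I(1)]
    unfolding bracket_L1_iterated by (simp add: integral_completion W_def[symmetric])
  have "norm ((LINT x|lborel. cnj (X.smoothing \<epsilon> x) * W x) - (LINT x|lborel. cnj (X.smoothing \<epsilon> x) * V x))
      = norm (LINT x|lborel. cnj (X.smoothing \<epsilon> x) * W x - cnj (X.smoothing \<epsilon> x) * V x)"
    using I by simp
  also have "\<dots> \<le> (LINT x|lborel. norm (X.smoothing \<epsilon> x) * (?H' * (K * (real CARD('n) * \<epsilon>))))"
  proof (rule norm_integral_le)
    fix x
    show "norm (cnj (X.smoothing \<epsilon> x) * W x - cnj (X.smoothing \<epsilon> x) * V x)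
        \<le> norm (X.smoothing \<epsilon> x) * (?H' * (K * (real CARD('n) * \<epsilon>)))"
      unfolding right_diff_distrib[symmetric] norm_mult complex_mod_cnj
      by (intro mult_left_mono WV) simp
  qed (use I X.integrable_smoothing[OF \<epsilon>] in auto)
  also have "\<dots> \<le> ?H * (?H' * (K * (real CARD('n) * \<epsilon>)))"
    using X.smoothing_norm[OF \<epsilon>] K0 \<epsilon> by (auto intro!: mult_right_mono)
  finally have 1: "norm ((LINT x|lborel. cnj (X.smoothing \<epsilon> x) * W x)
      - (LINT x|lborel. cnj (X.smoothing \<epsilon> x) * V x)) \<le> ?H * (?H' * (K * (real CARD('n) * \<epsilon>)))" .
  have "(LINT x|lborel. cnj (X.smoothing \<epsilon> x) * V x) - weighted_bracket M N h A N' h' A'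
      = cnj ((LINT x|lborel. X.smoothing \<epsilon> x * cnj (V x)) - pushforward N h A (\<lambda>x. cnj (V x)))"
    by (simp add: integral_cnj_mult weighted_bracket_def pushforward_def V_def)
  then have 2: "norm ((LINT x|lborel. cnj (X.smoothing \<epsilon> x) * V x) - weighted_bracket M N h A N' h' A')
      \<le> ?H * (?H' * K * (real CARD('n) * \<epsilon>))"
    using X.smoothing_approximates[OF \<epsilon> lipschitz_on_cnj[OF V(1)], of "?H' * B"] V(2)
    by (simp only: complex_mod_cnj)
  show ?thesis
    unfolding b using norm_triangle_mono[OF 1 2] by (simp add: algebra_simps)
qed

lemma schwartz_bounded_measurable:
  assumes "\<phi> \<in> schwartz"
  shows "\<phi> \<in> borel_measurable borel" and "\<exists>B. \<forall>x. norm (\<phi> x) \<le> B"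
proof -
  have "partials [] \<phi> differentiable at x" for x
    using assms unfolding schwartz_def smooth_def by blast
  then have "continuous_on UNIV \<phi>"
    by (intro continuous_at_imp_continuous_on) (auto intro: differentiable_imp_continuous_within)
  then show "\<phi> \<in> borel_measurable borel"
    by (rule borel_measurable_continuous_onI)
  have "bounded (range (\<lambda>x. (1 + norm x) ^ 0 *\<^sub>R partials [] \<phi> x))"
    using assms unfolding schwartz_def by blast
  then show "\<exists>B. \<forall>x. norm (\<phi> x) \<le> B"
    by (auto simp: bounded_iff)
qed

lemma (in weighted_map) dist_of_smoothing:
  assumes \<epsilon>: "\<epsilon> > 0"
  shows "dist_eq (dist_of (smoothing \<epsilon>)) (dist_conv (pushforward N h A) (gaussian \<epsilon>))"
  unfolding dist_eq_def
proof
  fix \<phi> :: "real^'n \<Rightarrow> complex" assume \<phi>: "\<phi> \<in> schwartz"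
  note [measurable] = schwartz_bounded_measurable(1)[OF \<phi>]
  have [measurable]: "smoothing \<epsilon> \<in> borel_measurable borel"
    using integrable_smoothing[OF \<epsilon>] by auto
  obtain B where B: "\<And>x. norm (\<phi> x) \<le> B"
    using schwartz_bounded_measurable(2)[OF \<phi>] by blast
  show "dist_of (smoothing \<epsilon>) \<phi> = dist_conv (pushforward N h A) (gaussian \<epsilon>) \<phi>"
    using smoothing_duality(1)[OF \<epsilon> _ B]
    by (simp add: dist_of_def dist_conv_def integral_completion)
qed

lemma has_bracket_pushforward:
  fixes M :: "(real^'n::finite) \<times> (real^'n) \<Rightarrow> complex"
  assumes X: "weighted_map N h A" and Y: "weighted_map N' h' A'"
    and K: "K-lipschitz_on UNIV M" and B: "\<And>z. norm (M z) \<le> B"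
  shows "has_bracket M (pushforward N h A) (pushforward N' h' A') (weighted_bracket M N h A N' h' A')"
proof -
  interpret X: weighted_map N h A by fact
  interpret Y: weighted_map N' h' A' by fact
  let ?b = "\<lambda>\<epsilon>. bracket_L1 M (X.smoothing \<epsilon>) (Y.smoothing \<epsilon>)"
  let ?L = "weighted_bracket M N h A N' h' A'"
  define C where "C = 2 * (LINT t|N. norm (h t)) * (LINT t|N'. norm (h' t)) * K * real CARD('n)"
  have "((\<lambda>\<epsilon>. ?b \<epsilon> - ?L) \<longlongrightarrow> 0) (at_right 0)"
  proof (rule Lim_null_comparison)
    show "\<forall>\<^sub>F \<epsilon> in at_right 0. norm (?b \<epsilon> - ?L) \<le> C * \<epsilon>"
      using eventually_at_right_less[of "0::real"]
      by eventually_elim (use bracket_L1_smoothing[OF X Y K B] in \<open>simp add: C_def\<close>)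
    show "((\<lambda>\<epsilon>. C * \<epsilon>) \<longlongrightarrow> 0) (at_right 0)"
      by (auto intro!: tendsto_eq_intros)
  qed
  then have "(?b \<longlongrightarrow> ?L) (at_right 0)"
    by (simp add: LIM_zero_iff)
  then show ?thesis
    unfolding has_bracket_def
    using X.integrable_smoothing Y.integrable_smoothing X.dist_of_smoothing Y.dist_of_smoothing
    by (intro exI[of _ X.smoothing] exI[of _ Y.smoothing])
      (auto simp: integrable_completion borel_measurable_integrable)
qed

text \<open>The difference \<open>D\<close> of the two functions annihilates the Gaussians centred at every point, so all
  its smoothings vanish identically. The approximation estimate for \<open>A = (\<lambda>x. x)\<close> then bounds the
  integral of \<open>D\<close> against \<open>\<psi>\<close> by a multiple of \<open>\<epsilon>\<close> for every \<open>\<epsilon>\<close>. Testing against Lipschitz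
  functions is all that brackets with a Lipschitz kernel see, so this replaces the statement that
  the functions agree almost everywhere.\<close>

lemma schwartz_tests_determine_lipschitz_tests:
  fixes F F' :: "real^'n::finite \<Rightarrow> complex"
  assumes F: "integrable lebesgue F" "integrable lebesgue F'"
    and eq: "\<And>\<phi>. \<phi> \<in> schwartz \<Longrightarrow> dist_of F \<phi> = dist_of F' \<phi>"
    and K: "K-lipschitz_on UNIV \<psi>" and B: "\<And>x. norm (\<psi> x) \<le> B"
  shows "(LINT x|lebesgue. F x * \<psi> x) = (LINT x|lebesgue. F' x * \<psi> x)"
proof -
  define D where "D x = F x - F' x" for x
  have D: "integrable lebesgue D"
    unfolding D_def using F by simp
  have id: "(\<lambda>x::real^'n. x) \<in> lebesgue \<rightarrow>\<^sub>M borel"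
    by (simp add: measurable_completion)
  interpret weighted_map lebesgue D "\<lambda>x. x"
    unfolding weighted_map_def weighted_map_axioms_def using D id sigma_finite_lebesgue by blast
  have diff: "(LINT x|lebesgue. D x * \<phi> x) = (LINT x|lebesgue. F x * \<phi> x) - (LINT x|lebesgue. F' x * \<phi> x)"
    if "\<phi> \<in> borel_measurable borel" and "\<And>x. norm (\<phi> x) \<le> b" for \<phi> b
  proof -
    have "\<phi> \<in> borel_measurable lebesgue"
      using that(1) by (simp add: measurable_completion)
    then have "integrable lebesgue (\<lambda>x. F x * \<phi> x)" "integrable lebesgue (\<lambda>x. F' x * \<phi> x)"
      using F that(2) by (auto intro: integrable_mult_bounded)
    then show ?thesis
      by (simp add: D_def left_diff_distrib)
  qed
  have zero: "smoothing \<epsilon> y = 0" if \<epsilon>: "\<epsilon> > 0" for \<epsilon> y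
  proof -
    have S: "(\<lambda>x. gaussian \<epsilon> (y - x)) \<in> schwartz"
      by (rule schwartz_gaussian[OF \<epsilon>])
    obtain b where "\<And>x. norm (gaussian \<epsilon> (y - x)) \<le> b"
      using schwartz_bounded_measurable(2)[OF S] by blast
    from diff[OF schwartz_bounded_measurable(1)[OF S] this] show ?thesis
      using eq[OF S] by (simp add: smoothing_def dist_of_def)
  qed
  define p where "p = norm (pushforward lebesgue D (\<lambda>x. x) \<psi>)"
  define C where "C = (LINT x|lebesgue. norm (D x)) * (K * real CARD('n))"
  have p: "p \<le> C * \<epsilon>" if "\<epsilon> > 0" for \<epsilon>
    using smoothing_approximates[OF that K B] by (simp add: zero[OF that] p_def C_def mult_ac)
  have "((\<lambda>\<epsilon>. C * \<epsilon>) \<longlongrightarrow> 0) (at_right 0)"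
    by (auto intro!: tendsto_eq_intros)
  moreover have "\<forall>\<^sub>F \<epsilon> in at_right 0. p \<le> C * \<epsilon>"
    using eventually_at_right_less[of "0::real"] by eventually_elim (rule p)
  ultimately have "p \<le> 0"
    by (rule tendsto_lowerbound) simp
  then have "(LINT x|lebesgue. D x * \<psi> x) = 0"
    by (simp add: p_def pushforward_def)
  then show ?thesis
    using diff[OF lipschitz_borel_measurable[OF K] B] by simp
qed

text \<open>Two admissible choices of smoothed functions have the same integrals against bounded Lipschitz
  functions. The kernel is such a function in its second argument, and after integrating
  that argument out the result is such a function of the first one; hence the
  approximating brackets agree for each \<open>\<epsilon>\<close>.\<close>

lemma has_bracket_unique:
  fixes M :: "(real^'n::finite) \<times> (real^'n) \<Rightarrow> complex"
  assumes K: "K-lipschitz_on UNIV M" and B: "\<And>z. norm (M z) \<le> B"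
    and L: "has_bracket M f g L" and L': "has_bracket M f g L'"
  shows "L = L'"
proof -
  obtain F G where FG: "\<And>\<epsilon>. \<epsilon> > 0 \<Longrightarrow> integrable lebesgue (F \<epsilon>) \<and> dist_eq (dist_of (F \<epsilon>)) (dist_conv f (gaussian \<epsilon>)) \<and>
            integrable lebesgue (G \<epsilon>) \<and> dist_eq (dist_of (G \<epsilon>)) (dist_conv g (gaussian \<epsilon>))"
    and lim: "((\<lambda>\<epsilon>. bracket_L1 M (F \<epsilon>) (G \<epsilon>)) \<longlongrightarrow> L) (at_right 0)"
    using L unfolding has_bracket_def by blast
  obtain F' G' where FG': "\<And>\<epsilon>. \<epsilon> > 0 \<Longrightarrow> integrable lebesgue (F' \<epsilon>) \<and> dist_eq (dist_of (F' \<epsilon>)) (dist_conv f (gaussian \<epsilon>)) \<and>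
            integrable lebesgue (G' \<epsilon>) \<and> dist_eq (dist_of (G' \<epsilon>)) (dist_conv g (gaussian \<epsilon>))"
    and lim': "((\<lambda>\<epsilon>. bracket_L1 M (F' \<epsilon>) (G' \<epsilon>)) \<longlongrightarrow> L') (at_right 0)"
    using L' unfolding has_bracket_def by blast
  have "bracket_L1 M (F \<epsilon>) (G \<epsilon>) = bracket_L1 M (F' \<epsilon>) (G' \<epsilon>)" if \<epsilon>: "\<epsilon> > 0" for \<epsilon>
  proof -
    define W where "W x = (LINT y|lebesgue. G \<epsilon> y * M (x, y))" for x
    have G: "(LINT y|lebesgue. G \<epsilon> y * M (x, y)) = (LINT y|lebesgue. G' \<epsilon> y * M (x, y))" for x
      by (rule schwartz_tests_determine_lipschitz_tests[OF _ _ _ lipschitz_on_slices(2)[OF K] B])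
        (use FG[OF \<epsilon>] FG'[OF \<epsilon>] in \<open>auto simp: dist_eq_def\<close>)
    have "(\<lambda>y. M (x, y)) \<in> borel_measurable lebesgue" for x
      using lipschitz_borel_measurable[OF lipschitz_on_slices(2)[OF K]] by (simp add: measurable_completion)
    then have W: "((LINT t|lebesgue. norm (G \<epsilon> t)) * K)-lipschitz_on UNIV W"
        "norm (W x) \<le> (LINT t|lebesgue. norm (G \<epsilon> t)) * B" for x
      unfolding W_def
      using FG[OF \<epsilon>] B lipschitz_on_slices(1)[OF K] lipschitz_on_nonneg[OF K]
      by (intro weighted_average_lipschitz; blast)+
    have "(LINT x|lebesgue. F \<epsilon> x * cnj (W x)) = (LINT x|lebesgue. F' \<epsilon> x * cnj (W x))"
      by (rule schwartz_tests_determine_lipschitz_tests[OF _ _ _ lipschitz_on_cnj[OF W(1)]])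
        (use FG[OF \<epsilon>] FG'[OF \<epsilon>] W(2) in \<open>auto simp: dist_eq_def\<close>)
    then show ?thesis
      unfolding bracket_L1_iterated G[symmetric] W_def[symmetric] integral_cnj_mult by simp
  qed
  then have "\<forall>\<^sub>F \<epsilon> in at_right 0. bracket_L1 M (F \<epsilon>) (G \<epsilon>) = bracket_L1 M (F' \<epsilon>) (G' \<epsilon>)"
    using eventually_at_right_less[of "0::real"] by (rule eventually_mono[rotated])
  with lim have "((\<lambda>\<epsilon>. bracket_L1 M (F' \<epsilon>) (G' \<epsilon>)) \<longlongrightarrow> L) (at_right 0)"
    by (rule Lim_transform_eventually)
  then show ?thesis
    using lim' tendsto_unique trivial_limit_at_right_real by blast
qed

lemma bracket_eqI:
  fixes M :: "(real^'n::finite) \<times> (real^'n) \<Rightarrow> complex"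
  assumes "K-lipschitz_on UNIV M" and "\<And>z. norm (M z) \<le> B" and "has_bracket M f g L"
  shows "bracket M f g = L"
  unfolding bracket_def using assms has_bracket_unique[OF assms(1,2)] by (intro the_equality) auto

section \<open>Brackets of coordinate multiples\<close>

lemma weighted_bracket_sum:
  fixes M :: "(real^'n::finite) \<times> (real^'n) \<Rightarrow> complex"
    and u :: "'i \<Rightarrow> 'a \<Rightarrow> complex" and v :: "'j \<Rightarrow> 'b \<Rightarrow> complex"
  assumes u: "\<And>l. l \<in> I \<Longrightarrow> integrable N (u l)" and A: "A \<in> borel_measurable N"
    and v: "\<And>m. m \<in> J \<Longrightarrow> integrable N' (v m)" and A': "A' \<in> borel_measurable N'"
    and K: "K-lipschitz_on UNIV M" and B: "\<And>z. norm (M z) \<le> B"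
  shows "weighted_bracket M N (\<lambda>s. \<Sum>l\<in>I. of_real (a l) * u l s) A N' (\<lambda>t. \<Sum>m\<in>J. of_real (b m) * v m t) A'
    = (\<Sum>l\<in>I. \<Sum>m\<in>J. of_real (a l * b m) * weighted_bracket M N (u l) A N' (v m) A')"
proof -
  define V where "V m x = (LINT t|N'. v m t * M (x, A' t))" for m x
  note [measurable] = A A' lipschitz_borel_measurable[OF lipschitz_on_slices(2)[OF K]]
  have V: "((LINT t|N'. norm (v m t)) * K)-lipschitz_on UNIV (V m)"
      "norm (V m x) \<le> (LINT t|N'. norm (v m t)) * B" if "m \<in> J" for m x
    unfolding V_def
    by (rule weighted_average_lipschitz[OF v[OF that] _ B lipschitz_on_slices(1)[OF K] lipschitz_on_nonneg[OF K]], simp)+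
  have inner: "(LINT t|N'. (\<Sum>m\<in>J. of_real (b m) * v m t) * M (x, A' t)) = (\<Sum>m\<in>J. of_real (b m) * V m x)" for x
  proof -
    have "integrable N' (\<lambda>t. v m t * M (x, A' t))" if "m \<in> J" for m
      by (rule integrable_mult_bounded[OF v[OF that] _ B]) simp
    then show ?thesis
      by (simp add: sum_distrib_right V_def mult.assoc Bochner_Integration.integral_sum)
  qed
  have outer: "integrable N (\<lambda>s. cnj (u l s) * V m (A s))" if "l \<in> I" "m \<in> J" for l m
  proof (rule integrable_mult_bounded[OF _ _ V(2)[OF that(2)]])
    show "integrable N (\<lambda>s. cnj (u l s))"
      using u[OF that(1)] by simp
    show "(\<lambda>s. V m (A s)) \<in> borel_measurable N"
      using measurable_compose[OF A lipschitz_borel_measurable[OF V(1)[OF that(2)]]] .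
  qed
  have "weighted_bracket M N (\<lambda>s. \<Sum>l\<in>I. of_real (a l) * u l s) A N' (\<lambda>t. \<Sum>m\<in>J. of_real (b m) * v m t) A'
      = (LINT s|N. (\<Sum>l\<in>I. \<Sum>m\<in>J. of_real (a l * b m) * (cnj (u l s) * V m (A s))))"
    unfolding weighted_bracket_def inner
    by (intro Bochner_Integration.integral_cong refl) (simp add: sum_product mult_ac)
  also have "\<dots> = (\<Sum>l\<in>I. \<Sum>m\<in>J. of_real (a l * b m) * (LINT s|N. cnj (u l s) * V m (A s)))"
    using outer by (simp add: Bochner_Integration.integral_sum)
  finally show ?thesis
    by (simp add: weighted_bracket_def V_def)
qed

text \<open>Rotation and tensor product with the delta merely compose the test function with the
  linear map \<open>A t = transpose U *v embed \<iota> t\<close>, so on the image the coordinate \<open>x $ i\<close> becomes the linear form \<open>(A t) $ i\<close>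
  and can be absorbed into the density.\<close>

lemma coord_mult_subspace_dist:
  "coord_mult i (dist_rotate U (tensor_delta \<iota> (dist_of g)))
    = pushforward lebesgue (\<lambda>t. of_real ((transpose U *v embed \<iota> t) $ i) * g t) (\<lambda>t. transpose U *v embed \<iota> t)"
  by (simp add: fun_eq_iff coord_mult_def dist_rotate_def tensor_delta_def dist_of_def pushforward_def mult_ac)

lemma matrix_mult_embed_component:
  fixes P :: "real^'n::finite^'n"
  shows "(P *v embed \<iota> t) $ i = (\<Sum>l\<in>UNIV. P $ i $ \<iota> l * t $ l)"
proof -
  have "P *v embed \<iota> t = (\<Sum>l\<in>UNIV. (t $ l) *\<^sub>R (P *v axis (\<iota> l) 1))"
    unfolding embed_def by (simp add: linear_sum[OF matrix_vector_mul_linear] linear_scale[OF matrix_vector_mul_linear])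
  then show ?thesis
    by (simp add: matrix_vector_mult_basis column_def mult_ac)
qed

theorem theorem4:
  fixes M :: "(real^'n::finite) \<times> (real^'n) \<Rightarrow> complex"
    and \<iota> :: "'k::finite \<Rightarrow> 'n"
    and U :: "real^'n^'n"
    and g :: "real^'k \<Rightarrow> complex"
    and f :: "'n functional"
  assumes "inj \<iota>"
    and "bounded (range M)"
    and "\<exists>C. C-lipschitz_on UNIV M"
    and "psd_kernel M"
    and "orthogonal_matrix U"
    and "induces_tempered g"
    and "f = dist_rotate U (tensor_delta \<iota> (dist_of g))"
    and "f \<in> subspace_dists \<iota>"
    and "\<forall>i. integrable lebesgue (\<lambda>x. of_real (x $ i) * g x)"
  shows "(\<forall>i j. bracket_defined M (coord_mult i f) (coord_mult j f)) \<and>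
         rank (bracket_matrix M f) \<le> CARD('k)"
proof -
  obtain K where K: "K-lipschitz_on UNIV M"
    using assms(3) by blast
  obtain B where B: "\<And>z. norm (M z) \<le> B"
    using assms(2) by (auto simp: bounded_iff)
  define A where "A t = transpose U *v embed \<iota> t" for t :: "real^'k"
  \<comment> \<open>\<open>P\<close> is the matrix of \<open>A\<close>, with one column for each coordinate of the small space.\<close>
  define P :: "real^'k^'n" where "P = (\<chi> i l. transpose U $ i $ \<iota> l)"
  define u where "u l t = of_real (t $ l) * g t" for l t
  define h where "h i t = (\<Sum>l\<in>UNIV. of_real (P $ i $ l) * u l t)" for i t
  have u: "integrable lebesgue (u l)" for l
    unfolding u_def using assms(9) by blast
  have A_component: "A t $ i = (\<Sum>l\<in>UNIV. P $ i $ l * t $ l)" for t i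
    by (simp only: A_def P_def matrix_mult_embed_component vec_lambda_beta)
  have "linear A"
    by (simp add: linear_iff vec_eq_iff A_component distrib_left sum.distrib sum_distrib_left mult_ac)
  then have A: "A \<in> borel_measurable lebesgue"
    by (intro measurable_completion) (simp add: borel_measurable_continuous_onI linear_continuous_on linear_linear)
  have "of_real ((A t) $ i) * g t = h i t" for i t
    by (simp add: A_component h_def u_def sum_distrib_left sum_distrib_right mult_ac)
  then have f: "coord_mult i f = pushforward lebesgue (h i) A" for i
    unfolding assms(7) coord_mult_subspace_dist A_def[symmetric] by simp
  have W: "weighted_map lebesgue (h i) A" for i
    unfolding weighted_map_def weighted_map_axioms_def h_def
    using A u sigma_finite_lebesgue by auto
  let ?Q = "\<lambda>l m. weighted_bracket M lebesgue (u l) A lebesgue (u m) A"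
  define L where "L i j = weighted_bracket M lebesgue (h i) A lebesgue (h j) A" for i j
  have L: "has_bracket M (coord_mult i f) (coord_mult j f) (L i j)" for i j
    unfolding f L_def by (rule has_bracket_pushforward[OF W W K B])
  \<comment> \<open>By sesquilinearity the bracket matrix is \<open>P Q P\<^sup>T\<close> for a square matrix \<open>Q\<close> of size \<open>k\<close>.\<close>
  have "bracket_matrix M f $ i $ j = (\<Sum>l\<in>UNIV. \<Sum>m\<in>UNIV. P $ i $ l * P $ j $ m * Re (?Q l m))" for i j
    unfolding bracket_matrix_def
    using bracket_eqI[OF K B L[of i j]]
      weighted_bracket_sum[where u=u and v=u and I=UNIV and J=UNIV and a="\<lambda>l. P $ i $ l"
        and b="\<lambda>m. P $ j $ m", OF u A u A K B]
    by (simp add: L_def h_def[abs_def] Re_sum)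
  then have "bracket_matrix M f = P ** ((\<chi> l m. Re (?Q l m)) ** transpose P)"
    by (simp add: vec_eq_iff matrix_matrix_mult_def transpose_def sum_distrib_left mult_ac)
  then have "rank (bracket_matrix M f) \<le> rank P"
    by (simp only: rank_mul_le_left)
  also have "\<dots> \<le> CARD('k)"
    using rank_bound[of P] by simp
  finally show ?thesis
    using L unfolding bracket_defined_def by blast
qed

end
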